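(* Let $m\le n$ be positive integers, let $\mathbf{A}\in\mathbb{R}^{m\times n}$, let $\mathbf{R}\in\mathbb{R}^{m\times m}$ be diagonal and symmetric positive definite, let $\mathbf{Q}\in\mathbb{R}^{n\times n}$ be symmetric positive definite, let $\boldsymbol{\mu}\in\mathbb{R}^n$, $\mathbf{d}\in\mathbb{R}^m$, and let $\pi[\bar{\boldsymbol{\theta}}]>0$ be a fixed real number. Put $\mathbf{Z}=\mathbf{A}\mathbf{Q}\mathbf{A}^\top+\mathbf{R}$ and $$\bar{\mathcal{F}}=-\log\pi[\bar{\boldsymbol{\theta}}]+\tfrac12\log\det(\mathbf{Z})+\tfrac12\|\mathbf{A}\boldsymbol{\mu}-\mathbf{d}\|_{\mathbf{Z}^{-1}}^2 .$$ Let $\widehat{\mathbf{A}}=\mathbf{R}^{-1/2}\mathbf{A}\mathbf{Q}^{1/2}$, let $r=\mathrm{rank}(\widehat{\mathbf{A}})$, and let $\sigma_1(\widehat{\mathbf{A}})\ge\sigma_2(\widehat{\mathbf{A}})\ge\cdots\ge\sigma_r(\widehat{\mathbf{A}})>\sigma_{r+1}(\widehat{\mathbf{A}})=\cdots=\sigma_{\min\{m,n\}}(\widehat{\mathbf{A}})=0$ be its singular values. For $1\le k<r$, let $\widehat{\mathbf{A}}_k=\mathbf{U}\boldsymbol{\Sigma}_k\mathbf{V}^\top$ be the rank-$k$ truncated singular value decomposition of $\widehat{\mathbf{A}}$, and define $$\mathbf{Z}_k=\mathbf{R}^{1/2}\left[\widehat{\mathbf{A}}_k\widehat{\mathbf{A}}_k^\top+\mathbf{I}_m\right]\mathbf{R}^{1/2},\qquad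 \widehat{\mathcal{F}}_k=-\log\pi[\bar{\boldsymbol{\theta}}]+\tfrac12\log\det(\mathbf{Z}_k)+\tfrac12\|\mathbf{A}\boldsymbol{\mu}-\mathbf{d}\|_{\mathbf{Z}_k^{-1}}^2 .$$ Then $$|\bar{\mathcal{F}}-\widehat{\mathcal{F}}_k|\le\frac12\sum_{i=k+1}^{r}\log\left(1+\sigma_i^2(\widehat{\mathbf{A}})\right)+\frac12\beta_1^2\left(\frac{\sigma_{k+1}^2(\widehat{\mathbf{A}})}{1+\sigma_{k+1}^2(\widehat{\mathbf{A}})}\right),$$ where $\beta_1=\|\mathbf{A}\boldsymbol{\mu}-\mathbf{d}\|_{\mathbf{R}^{-1}}$.
   Context: For a symmetric positive definite matrix $\mathbf{M}$, $\|\mathbf{x}\|_{\mathbf{M}}=\sqrt{\mathbf{x}^\top\mathbf{M}\mathbf{x}}$. $\mathbf{M}^{1/2}$ denotes the symmetric positive definite square root of $\mathbf{M}$ and $\mathbf{M}^{-1/2}$ its inverse. $\mathbf{I}_m$ is the $m\times m$ identity matrix. The rank-$k$ truncated SVD is obtained from a singular value decomposition $\widehat{\mathbf{A}}=\mathbf{U}\boldsymbol{\Sigma}\mathbf{V}^\top$ (singular values in nonincreasing order) by replacing all singular values with index larger than $k$ by zero in $\boldsymbol{\Sigma}$, giving $\boldsymbol{\Sigma}_k$. Here $\bar{\boldsymbol{\theta}}$ is a fixed vector of hyperparameters at which all quantities are evaluated, and $\pi[\bar{\boldsymbol{\theta}}]$ is the value of the prior density there. *)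

theory Defs
  imports Complex_Main "Jordan_Normal_Form.DL_Rank" "Jordan_Normal_Form.Gauss_Jordan_Elimination"
begin

definition spd_mat :: "real mat \<Rightarrow> bool" where
  "spd_mat M \<longleftrightarrow> square_mat M \<and> transpose_mat M = M \<and>
     (\<forall>x \<in> carrier_vec (dim_row M). x \<noteq> 0\<^sub>v (dim_row M) \<longrightarrow> 0 < x \<bullet> (M *\<^sub>v x))"

(* mat_inverse returns None on singular matrices; inv_mat M is unspecified there. *)
definition inv_mat :: "real mat \<Rightarrow> real mat" where
  "inv_mat M = the (mat_inverse M)"

(* Meaningful for symmetric positive definite M, for which S exists and is unique. *)
definition sqrt_mat :: "real mat \<Rightarrow> real mat" where
  "sqrt_mat M = (THE S. spd_mat S \<and> S * S = M)"

definition mat_norm :: "real mat \<Rightarrow> real vec \<Rightarrow> real" where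
  "mat_norm M x = sqrt (x \<bullet> (M *\<^sub>v x))"

definition orthonormal_mat :: "nat \<Rightarrow> real mat \<Rightarrow> bool" where
  "orthonormal_mat n U \<longleftrightarrow> U \<in> carrier_mat n n \<and>
     transpose_mat U * U = 1\<^sub>m n \<and> U * transpose_mat U = 1\<^sub>m n"

(* Singular values are numbered from 1 while matrix entries are indexed from 0. *)
definition sigma_mat :: "nat \<Rightarrow> nat \<Rightarrow> (nat \<Rightarrow> real) \<Rightarrow> real mat" where
  "sigma_mat m n \<sigma> = mat m n (\<lambda>(i, j). if i = j then \<sigma> (Suc i) else 0)"

(* Full singular value decomposition; only \<sigma> 1, ..., \<sigma> (min m n) matter, where m x n is
   the size of the matrix. *)
definition is_svd :: "real mat \<Rightarrow> real mat \<Rightarrow> (nat \<Rightarrow> real) \<Rightarrow> real mat \<Rightarrow> bool" where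
  "is_svd B U \<sigma> V \<longleftrightarrow>
     orthonormal_mat (dim_row B) U \<and> orthonormal_mat (dim_col B) V \<and>
     (\<forall>i \<in> {1..min (dim_row B) (dim_col B)}. 0 \<le> \<sigma> i) \<and>
     (\<forall>i \<in> {1..min (dim_row B) (dim_col B)}.
        \<forall>j \<in> {1..min (dim_row B) (dim_col B)}. i \<le> j \<longrightarrow> \<sigma> j \<le> \<sigma> i) \<and>
     B = U * sigma_mat (dim_row B) (dim_col B) \<sigma> * transpose_mat V"

definition truncated_svd :: "nat \<Rightarrow> real mat \<Rightarrow> (nat \<Rightarrow> real) \<Rightarrow> real mat \<Rightarrow> real mat" where
  "truncated_svd k U \<sigma> V =
     U * sigma_mat (dim_row U) (dim_row V) (\<lambda>i. if i \<le> k then \<sigma> i else 0) * transpose_mat V"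

end

theory Submission
  imports Defs "Jordan_Normal_Form.Spectral_Radius"
begin

text \<open>
  With \<open>L = R\<^sup>1\<^sup>/\<^sup>2\<close> one has \<open>Z = L (Ahat Ahat\<^sup>T + I) L\<close>, and the singular value decomposition
  \<open>Ahat = U \<Sigma> V\<^sup>T\<close> turns this into a congruence \<open>Z = C D C\<^sup>T\<close>, where \<open>C = L U\<close> and \<open>D\<close> is diagonal with
  entries \<open>1 + \<sigma>\<^sub>i\<^sup>2\<close>. The same \<open>C\<close> serves for \<open>Z\<^sub>k\<close>, where the entries beyond \<open>k\<close> are replaced by 1, and
  for \<open>R = C C\<^sup>T\<close>. Hence the two log-determinants differ by the sum of \<open>ln (1 + \<sigma>\<^sub>i\<^sup>2)\<close> over \<open>i > k\<close>.
  With \<open>x = C\<^sup>-\<^sup>1 (A \<mu> - d)\<close> the two quadratic terms are sums of \<open>x\<^sub>i\<^sup>2\<close> divided by the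
  diagonal entries, and \<open>\<beta>\<^sub>1\<^sup>2\<close> is the sum of the \<open>x\<^sub>i\<^sup>2\<close>; they differ by the sum over \<open>i > k\<close> of
  \<open>x\<^sub>i\<^sup>2 \<sigma>\<^sub>i\<^sup>2 / (1 + \<sigma>\<^sub>i\<^sup>2)\<close>, which is at most \<open>\<beta>\<^sub>1\<^sup>2 \<sigma>\<^sup>2 / (1 + \<sigma>\<^sup>2)\<close> at \<open>\<sigma> = \<sigma>\<^sub>k\<^sub>+\<^sub>1\<close>, since
  \<open>u / (1 + u)\<close> is increasing for \<open>u \<ge> 0\<close>. The triangle inequality gives the claim.

  Two facts of linear algebra support this. The square root in \<open>sqrt_mat\<close> is a definite description, so
  its existence and uniqueness are needed (\<open>sqrt_mat_spd\<close>); both follow from the spectral theorem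
  \<open>symmetric_mat_diagonalization\<close>. To stop the logarithmic sum at the rank \<open>r\<close>, the
  singular values after the \<open>r\<close>-th must vanish (\<open>singular_value_zero_beyond_rank\<close>). The congruence argument
  itself is \<open>truncation_bound_congruence\<close>.
\<close>

section \<open>Diagonalization of real symmetric matrices\<close>

lemma scalar_prod_self_nonneg: "0 \<le> u \<bullet> (u :: real vec)"
  by (simp add: scalar_prod_def sum_nonneg)

lemma scalar_prod_self_pos:
  fixes u :: "real vec"
  assumes "u \<in> carrier_vec n" "u \<noteq> 0\<^sub>v n"
  shows "0 < u \<bullet> u"
proof -
  from assms obtain i where i: "i < n" "u $ i \<noteq> 0" by (metis carrier_vecD eq_vecI index_zero_vec)
  hence "0 < (\<Sum>i\<in>{0..<n}. u $ i * u $ i)" by (intro sum_pos2[of _ i]) (auto simp: linorder_neq_iff zero_less_mult_iff)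
  thus ?thesis using assms(1) by (simp add: scalar_prod_def)
qed

text \<open>
  Take an eigenvector \<open>x + i y\<close> of \<open>M\<close> over the complex numbers with eigenvalue \<open>z\<close>. Comparing
  \<open>x \<bullet> M y\<close> with \<open>y \<bullet> M x\<close> gives \<open>Im z * (x \<bullet> x + y \<bullet> y) = 0\<close>, so \<open>z\<close> is real, and
  whichever of \<open>x\<close> and \<open>y\<close> is nonzero is a real eigenvector.
\<close>
lemma symmetric_mat_has_unit_eigenvector:
  fixes M :: "real mat"
  assumes M: "M \<in> carrier_mat n n" and sym: "transpose_mat M = M" and n: "0 < n"
  obtains v l where "v \<in> carrier_vec n" "v \<bullet> v = 1" "M *\<^sub>v v = l \<cdot>\<^sub>v v"
proof -
  define MC where "MC = map_mat complex_of_real M"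
  have MC: "MC \<in> carrier_mat n n" unfolding MC_def using M by simp
  from spectrum_non_empty[OF MC n] obtain z where "eigenvalue MC z"
    unfolding spectrum_def by auto
  then obtain w where w: "w \<in> carrier_vec n" "w \<noteq> 0\<^sub>v n" and ev: "MC *\<^sub>v w = z \<cdot>\<^sub>v w"
    unfolding eigenvalue_def eigenvector_def using MC by auto
  define x where "x = map_vec Re w"
  define y where "y = map_vec Im w"
  have xc: "x \<in> carrier_vec n" and yc: "y \<in> carrier_vec n"
    unfolding x_def y_def using w by auto
  have comp: "(\<Sum>j<n. complex_of_real (M $$ (i,j)) * w $ j) = z * w $ i" if i: "i < n" for i
  proof -
    have "(MC *\<^sub>v w) $ i = (z \<cdot>\<^sub>v w) $ i" using ev by simp
    thus ?thesis using i M w unfolding MC_def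
      by (simp add: scalar_prod_def row_def atLeast0LessThan)
  qed
  have Mx: "M *\<^sub>v x = Re z \<cdot>\<^sub>v x - Im z \<cdot>\<^sub>v y"
  proof (rule eq_vecI)
    fix i assume "i < dim_vec (Re z \<cdot>\<^sub>v x - Im z \<cdot>\<^sub>v y)"
    hence i: "i < n" using yc by simp
    have "Re (\<Sum>j<n. complex_of_real (M $$ (i,j)) * w $ j) = Re (z * w $ i)" using comp[OF i] by simp
    thus "(M *\<^sub>v x) $ i = (Re z \<cdot>\<^sub>v x - Im z \<cdot>\<^sub>v y) $ i"
      using i M w unfolding x_def y_def by (simp add: scalar_prod_def row_def atLeast0LessThan)
  qed (use M yc in auto)
  have My: "M *\<^sub>v y = Im z \<cdot>\<^sub>v x + Re z \<cdot>\<^sub>v y"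
  proof (rule eq_vecI)
    fix i assume "i < dim_vec (Im z \<cdot>\<^sub>v x + Re z \<cdot>\<^sub>v y)"
    hence i: "i < n" using yc by simp
    have "Im (\<Sum>j<n. complex_of_real (M $$ (i,j)) * w $ j) = Im (z * w $ i)" using comp[OF i] by simp
    thus "(M *\<^sub>v y) $ i = (Im z \<cdot>\<^sub>v x + Re z \<cdot>\<^sub>v y) $ i"
      using i M w unfolding x_def y_def by (simp add: scalar_prod_def row_def atLeast0LessThan)
  qed (use M yc in auto)
  have selfadj: "x \<bullet> (M *\<^sub>v y) = y \<bullet> (M *\<^sub>v x)"
    using transpose_vec_mult_scalar[OF M yc xc] sym
    by (metis M comm_scalar_prod mult_mat_vec_carrier xc yc)
  have e1: "x \<bullet> (M *\<^sub>v y) = Im z * (x \<bullet> x) + Re z * (x \<bullet> y)"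
    unfolding My using xc yc
    by (subst scalar_prod_add_distrib[of _ n]) auto
  have e2: "y \<bullet> (M *\<^sub>v x) = Re z * (x \<bullet> y) - Im z * (y \<bullet> y)"
    unfolding Mx using xc yc comm_scalar_prod[OF xc yc]
    by (subst scalar_prod_minus_distrib[of _ n]) auto
  have sum0: "Im z * (x \<bullet> x + y \<bullet> y) = 0" using selfadj e1 e2 by (simp add: algebra_simps)
  note pos = scalar_prod_self_pos and nonneg = scalar_prod_self_nonneg
  have xy: "x \<noteq> 0\<^sub>v n \<or> y \<noteq> 0\<^sub>v n"
  proof (rule ccontr)
    assume "\<not> ?thesis"
    hence "x = 0\<^sub>v n" "y = 0\<^sub>v n" by auto
    hence "w $ i = 0" if "i < n" for i
      using that w unfolding x_def y_def
      by (metis carrier_vecD complex_eqI index_map_vec(1) index_zero_vec(1) zero_complex.sel)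
    hence "w = 0\<^sub>v n" using w by (intro eq_vecI) auto
    with w show False by simp
  qed
  have "x \<bullet> x + y \<bullet> y > 0"
    using xy pos[OF xc] pos[OF yc] nonneg[of x] nonneg[of y] by linarith
  hence im: "Im z = 0" using sum0 by simp
  obtain u where u: "u \<in> carrier_vec n" "u \<noteq> 0\<^sub>v n" "M *\<^sub>v u = Re z \<cdot>\<^sub>v u"
  proof (cases "x = 0\<^sub>v n")
    case False
    have "M *\<^sub>v x = Re z \<cdot>\<^sub>v x" unfolding Mx im using xc yc by auto
    with False xc that show ?thesis by blast
  next
    case True
    hence "y \<noteq> 0\<^sub>v n" using xy by simp
    moreover have "M *\<^sub>v y = Re z \<cdot>\<^sub>v y" unfolding My im using xc yc by auto
    ultimately show ?thesis using yc that by blast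
  qed
  define v where "v = (1 / sqrt (u \<bullet> u)) \<cdot>\<^sub>v u"
  have "v \<in> carrier_vec n" unfolding v_def using u by simp
  moreover have "v \<bullet> v = 1" unfolding v_def using u pos[OF u(1,2)] by simp
  moreover have "M *\<^sub>v v = Re z \<cdot>\<^sub>v v"
    unfolding v_def using M u by (simp add: mult_mat_vec smult_smult_assoc mult.commute)
  ultimately show ?thesis using that by blast
qed

text \<open>
  Every unit vector is the first column of a symmetric orthogonal matrix, namely of the Householder
  reflection along \<open>w = e\<^sub>0 - v\<close>.
\<close>
lemma householder_reflection:
  fixes v :: "real vec"
  assumes v: "v \<in> carrier_vec n" and unit: "v \<bullet> v = 1" and n: "0 < n"
  obtains H where "H \<in> carrier_mat n n" "transpose_mat H = H" "H * H = 1\<^sub>m n" "col H 0 = v"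
proof -
  define w where "w = unit_vec n 0 - v"
  \<comment> \<open>This is \<open>2 / (w \<bullet> w)\<close>. If \<open>v = e\<^sub>0\<close>, division by zero gives \<open>c = 0\<close> and \<open>H\<close> is the identity.\<close>
  define c where "c = 1 / (1 - v $ 0)"
  define H where "H = mat n n (\<lambda>(i,j). (if i = j then 1 else 0) - c * (w $ i * w $ j))"
  have w_i: "w $ i = (if i = 0 then 1 else 0) - v $ i" if "i < n" for i
    using that v n unfolding w_def unit_vec_def by simp
  have vsum: "(\<Sum>i<n. (v $ i)\<^sup>2) = 1"
    using unit v by (simp add: scalar_prod_def power2_eq_square atLeast0LessThan)
  have wsum: "(\<Sum>i<n. w $ i * w $ i) = 2 * (1 - v $ 0)"
  proof -
    have "(\<Sum>i<n. w $ i * w $ i) = (\<Sum>i<n. (if i = 0 then 1 - 2 * v $ 0 else 0) + (v $ i)\<^sup>2)"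
      by (intro sum.cong) (auto simp: w_i power2_eq_square algebra_simps)
    also have "\<dots> = 2 * (1 - v $ 0)" using n by (simp add: sum.distrib vsum)
    finally show ?thesis .
  qed
  have cc: "c * c * (\<Sum>i<n. w $ i * w $ i) = 2 * c"
  proof -
    have "1 / t * (1 / t) * (2 * t) = 2 * (1 / t)" for t :: real by (cases "t = 0") auto
    thus ?thesis unfolding wsum c_def .
  qed
  have H: "H \<in> carrier_mat n n" unfolding H_def by simp
  moreover have "transpose_mat H = H" unfolding H_def by (rule eq_matI) (auto simp: mult.commute)
  moreover have "H * H = 1\<^sub>m n"
  proof (rule eq_matI)
    fix i j assume "i < dim_row (1\<^sub>m n :: real mat)" "j < dim_col (1\<^sub>m n :: real mat)"
    hence i: "i < n" and j: "j < n" by auto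
    have "(H * H) $$ (i,j) = (\<Sum>k<n. H $$ (i,k) * H $$ (k,j))"
      using H i j by (simp add: scalar_prod_def atLeast0LessThan)
    also have "\<dots> = (\<Sum>k<n. (if k = i then (if i = j then 1 else 0) - c * (w $ i * w $ j) else 0)
        + (if k = j then - c * (w $ i * w $ j) else 0) + (w $ i * w $ j) * (c * c * (w $ k * w $ k)))"
      using i j unfolding H_def by (intro sum.cong) (auto simp: algebra_simps)
    also have "\<dots> = (if i = j then 1 else 0) - 2 * c * (w $ i * w $ j)
        + (w $ i * w $ j) * (c * c * (\<Sum>k<n. w $ k * w $ k))"
      using i j by (simp add: sum.distrib sum_distrib_left)
    also have "\<dots> = (if i = j then 1 else 0)" unfolding cc by simp
    finally show "(H * H) $$ (i,j) = (1\<^sub>m n :: real mat) $$ (i,j)" using i j by simp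
  qed (use H in auto)
  moreover have "col H 0 = v"
  proof (rule eq_vecI)
    fix i assume "i < dim_vec v"
    hence i: "i < n" using v by simp
    show "col H 0 $ i = v $ i"
    proof (cases "v $ 0 = 1")
      case False
      hence "c * w $ 0 = 1" using n by (simp add: w_i c_def)
      hence "c * (w $ i * w $ 0) = w $ i" by (metis mult.commute mult.left_commute mult_1_right)
      moreover have "col H 0 $ i = (if i = 0 then 1 else 0) - c * (w $ i * w $ 0)"
        unfolding H_def using i n by simp
      ultimately have "col H 0 $ i = (if i = 0 then 1 else 0) - w $ i" by simp
      thus ?thesis unfolding w_i[OF i] by simp
    next
      case True
      \<comment> \<open>A unit vector with leading entry 1 has no other nonzero entry.\<close>
      have "(\<Sum>i\<in>{..<n} - {0}. (v $ i)\<^sup>2) = 0"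
        using vsum n True by (simp add: sum_diff1)
      hence "\<forall>i\<in>{..<n} - {0}. (v $ i)\<^sup>2 = 0"
        by (subst (asm) sum_nonneg_eq_0_iff) auto
      moreover have "c = 0" unfolding c_def True by simp
      hence "col H 0 $ i = (if i = 0 then 1 else 0)" unfolding H_def using i n by simp
      ultimately show ?thesis using i True by (cases "i = 0") simp_all
    qed
  qed (use H v in auto)
  ultimately show ?thesis using that by blast
qed

lemma orthonormal_matI:
  assumes "P \<in> carrier_mat n n" "transpose_mat P * P = 1\<^sub>m n"
  shows "orthonormal_mat n P"
  unfolding orthonormal_mat_def using assms mat_mult_left_right_inverse[of "transpose_mat P" n P] by auto

lemma transpose_mat_diag[simp]: "transpose_mat (mat_diag n f) = mat_diag n f"
  by (rule eq_matI) (auto simp: mat_diag_def)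

lemma dim_mat_diag[simp]: "dim_row (mat_diag n f) = n" "dim_col (mat_diag n f) = n"
  by (simp_all add: mat_diag_def)

lemma transpose_congruence:
  fixes C :: "'a :: comm_ring_1 mat"
  assumes C: "C \<in> carrier_mat m n" and D: "D \<in> carrier_mat n n"
  shows "transpose_mat (C * D * transpose_mat C) = C * transpose_mat D * transpose_mat C"
proof -
  have Ct: "transpose_mat C \<in> carrier_mat n m" and Dt: "transpose_mat D \<in> carrier_mat n n"
    using C D by auto
  show ?thesis
    unfolding transpose_mult[OF mult_carrier_mat[OF C D] Ct] transpose_mult[OF C D]
    using assoc_mult_mat[OF C Dt Ct] by simp
qed

lemma congruence_congruence:
  fixes A B D :: "'a :: comm_ring_1 mat"
  assumes A: "A \<in> carrier_mat n n" and B: "B \<in> carrier_mat n n" and D: "D \<in> carrier_mat n n"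
  shows "(A * B) * D * transpose_mat (A * B) = A * (B * D * transpose_mat B) * transpose_mat A"
proof -
  have "transpose_mat A \<in> carrier_mat n n" "transpose_mat B \<in> carrier_mat n n" using A B by auto
  thus ?thesis using A B D
    by (simp add: transpose_mult[OF A B] assoc_mult_mat[of _ n n _ n _ n])
qed

lemma congruence_mult_vec:
  fixes C D :: "'a :: comm_ring_1 mat"
  assumes C: "C \<in> carrier_mat n n" and D: "D \<in> carrier_mat n n" and x: "x \<in> carrier_vec n"
  shows "(C * D * transpose_mat C) *\<^sub>v x = C *\<^sub>v (D *\<^sub>v (transpose_mat C *\<^sub>v x))"
proof -
  have Ct: "transpose_mat C \<in> carrier_mat n n" using C by simp
  show ?thesis
    using assoc_mult_mat_vec[OF mult_carrier_mat[OF C D] Ct x]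
      assoc_mult_mat_vec[OF C D mult_mat_vec_carrier[OF Ct x]] by simp
qed

lemma orthonormal_congruence_mult:
  assumes P: "orthonormal_mat n P" and D: "D \<in> carrier_mat n n" and E: "E \<in> carrier_mat n n"
  shows "(P * D * transpose_mat P) * (P * E * transpose_mat P) = P * (D * E) * transpose_mat P"
proof -
  have Pc: "P \<in> carrier_mat n n" and PP: "transpose_mat P * P = 1\<^sub>m n"
    using P unfolding orthonormal_mat_def by auto
  have Pt: "transpose_mat P \<in> carrier_mat n n" using Pc by simp
  have "(P * D * transpose_mat P) * (P * E * transpose_mat P)
      = P * D * (transpose_mat P * P) * (E * transpose_mat P)"
    using Pc Pt D E by (simp add: assoc_mult_mat[of _ n n _ n _ n])
  also have "\<dots> = P * (D * E) * transpose_mat P"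
    unfolding PP using Pc Pt D E by (simp add: assoc_mult_mat[of _ n n _ n _ n])
  finally show ?thesis .
qed

lemma block_diag_mult:
  fixes A A' D D' :: "'a :: comm_ring_1 mat"
  assumes A: "A \<in> carrier_mat m m" and A': "A' \<in> carrier_mat m m"
    and D: "D \<in> carrier_mat n n" and D': "D' \<in> carrier_mat n n"
  shows "four_block_mat A (0\<^sub>m m n) (0\<^sub>m n m) D * four_block_mat A' (0\<^sub>m m n) (0\<^sub>m n m) D'
           = four_block_mat (A * A') (0\<^sub>m m n) (0\<^sub>m n m) (D * D')"
  unfolding mult_four_block_mat[OF A zero_carrier_mat zero_carrier_mat D A' zero_carrier_mat zero_carrier_mat D']
  using assms by simp

text \<open>
  The spectral theorem for real symmetric matrices, by induction on the dimension: conjugating with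
  a reflection that sends \<open>e\<^sub>0\<close> to a unit eigenvector splits off a \<open>1 \<times> 1\<close> block.
\<close>
theorem symmetric_mat_diagonalization:
  fixes M :: "real mat"
  assumes "M \<in> carrier_mat n n" and "transpose_mat M = M"
  shows "\<exists>P f. orthonormal_mat n P \<and> M = P * mat_diag n f * transpose_mat P"
  using assms
proof (induction n arbitrary: M)
  case 0
  have "orthonormal_mat 0 (1\<^sub>m 0)" by (rule orthonormal_matI) auto
  moreover have "M = 1\<^sub>m 0 * mat_diag 0 f * transpose_mat (1\<^sub>m 0)" for f
    using 0 by (intro eq_matI) auto
  ultimately show ?case by blast
next
  case (Suc n)
  note M = Suc.prems(1) and sym = Suc.prems(2)
  obtain v l where v: "v \<in> carrier_vec (Suc n)" "v \<bullet> v = 1" and ev: "M *\<^sub>v v = l \<cdot>\<^sub>v v"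
    using symmetric_mat_has_unit_eigenvector[OF M sym] by auto
  obtain H where H: "H \<in> carrier_mat (Suc n) (Suc n)" and Ht: "transpose_mat H = H"
    and HH: "H * H = 1\<^sub>m (Suc n)" and H0: "col H 0 = v"
    using householder_reflection[OF v] by auto
  define B where "B = H * M * H"
  have B: "B \<in> carrier_mat (Suc n) (Suc n)" unfolding B_def using H M by simp
  have Bt: "transpose_mat B = B"
  proof -
    show ?thesis unfolding B_def using transpose_congruence[OF H M] by (simp add: Ht sym)
  qed
  have Hv: "H *\<^sub>v v = unit_vec (Suc n) 0"
  proof -
    have "H *\<^sub>v v = col (H * H) 0" unfolding H0[symmetric] using col_mult2[OF H H] by simp
    thus ?thesis unfolding HH by simp
  qed
  have B0: "col B 0 = l \<cdot>\<^sub>v unit_vec (Suc n) 0"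
  proof -
    have "col B 0 = H * M *\<^sub>v v"
      unfolding B_def H0[symmetric] by (rule col_mult2) (use H M in auto)
    also have "\<dots> = H *\<^sub>v (M *\<^sub>v v)" using H M v by simp
    also have "\<dots> = l \<cdot>\<^sub>v unit_vec (Suc n) 0"
      unfolding ev using H v Hv by (simp add: mult_mat_vec)
    finally show ?thesis .
  qed
  have Bi0: "B $$ (i,0) = (if i = 0 then l else 0)" if "i < Suc n" for i
  proof -
    have "B $$ (i,0) = col B 0 $ i" using B that by simp
    thus ?thesis unfolding B0 using that by (simp add: unit_vec_def)
  qed
  have B0i: "B $$ (0,i) = (if i = 0 then l else 0)" if "i < Suc n" for i
    using Bi0[OF that] Bt B that by (metis carrier_matD index_transpose_mat(1) zero_less_Suc)
  define C where "C = mat n n (\<lambda>(i,j). B $$ (Suc i, Suc j))"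
  have C: "C \<in> carrier_mat n n" unfolding C_def by simp
  have "transpose_mat C = C"
  proof (rule eq_matI)
    fix i j assume "i < dim_row C" "j < dim_col C"
    thus "transpose_mat C $$ (i,j) = C $$ (i,j)"
      using Bt B unfolding C_def by (auto) (metis Suc_mono carrier_matD index_transpose_mat(1))
  qed (use C in auto)
  from Suc.IH[OF C this] obtain P f where P: "orthonormal_mat n P"
    and CP: "C = P * mat_diag n f * transpose_mat P" by blast
  have Pc: "P \<in> carrier_mat n n" and PP: "transpose_mat P * P = 1\<^sub>m n"
    using P unfolding orthonormal_mat_def by auto
  define L where "L = mat 1 1 (\<lambda>_. l)"
  define W where "W = four_block_mat (1\<^sub>m 1) (0\<^sub>m 1 n) (0\<^sub>m n 1) P"
  define g where "g i = (case i of 0 \<Rightarrow> l | Suc j \<Rightarrow> f j)" for i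
  have W: "W \<in> carrier_mat (Suc n) (Suc n)"
    unfolding W_def using four_block_carrier_mat[of "1\<^sub>m 1" 1 1 P n n] Pc by simp
  have Wt: "transpose_mat W = four_block_mat (1\<^sub>m 1) (0\<^sub>m 1 n) (0\<^sub>m n 1) (transpose_mat P)"
    unfolding W_def using Pc by (subst transpose_four_block_mat) auto
  have Pt: "transpose_mat P \<in> carrier_mat n n" using Pc by simp
  have WW: "transpose_mat W * W = 1\<^sub>m (Suc n)"
    unfolding Wt unfolding W_def block_diag_mult[OF one_carrier_mat one_carrier_mat Pt Pc] PP
      left_mult_one_mat[OF one_carrier_mat] four_block_one_mat by simp
  have Bblock: "B = four_block_mat L (0\<^sub>m 1 n) (0\<^sub>m n 1) C"
    using B C Bi0 B0i by (intro eq_matI) (auto simp: L_def C_def)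
  have gblock: "mat_diag (Suc n) g = four_block_mat L (0\<^sub>m 1 n) (0\<^sub>m n 1) (mat_diag n f)"
  proof (rule eq_matI, goal_cases)
    case (1 i j)
    thus ?case by (cases i; cases j) (simp_all add: L_def mat_diag_def g_def)
  qed (simp_all add: L_def)
  have L: "L \<in> carrier_mat 1 1" unfolding L_def by simp
  have BW: "B = W * mat_diag (Suc n) g * transpose_mat W"
    unfolding gblock Wt Bblock CP unfolding W_def
      block_diag_mult[OF one_carrier_mat L Pc mat_diag_dim]
      left_mult_one_mat[OF L] block_diag_mult[OF L one_carrier_mat mult_carrier_mat[OF Pc mat_diag_dim] Pt]
      right_mult_one_mat[OF L] ..
  let ?G = "mat_diag (Suc n) g"
  have G: "?G \<in> carrier_mat (Suc n) (Suc n)" by simp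
  have "orthonormal_mat (Suc n) (H * W)"
  proof (rule orthonormal_matI)
    have "transpose_mat (H * W) * (H * W) = transpose_mat W * (H * H) * W"
      using H W Ht by (simp add: transpose_mult[of _ "Suc n" "Suc n"] assoc_mult_mat[of _ "Suc n" "Suc n" _ "Suc n" _ "Suc n"])
    thus "transpose_mat (H * W) * (H * W) = 1\<^sub>m (Suc n)" using HH WW W by simp
  qed (use H W in auto)
  moreover have "M = (H * W) * ?G * transpose_mat (H * W)"
  proof -
    have "(H * W) * ?G * transpose_mat (H * W) = H * (W * ?G * transpose_mat W) * H"
      using congruence_congruence[OF H W G] by (simp add: Ht)
    also have "\<dots> = (H * H) * M * (H * H)" unfolding BW[symmetric] B_def
      using H M by (simp add: assoc_mult_mat[of _ "Suc n" "Suc n" _ "Suc n" _ "Suc n"])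
    finally show ?thesis unfolding HH using M by simp
  qed
  ultimately show ?case by blast
qed

section \<open>Square roots of symmetric positive definite matrices\<close>

lemma mult_mat_zero_vec: "M \<in> carrier_mat m n \<Longrightarrow> M *\<^sub>v 0\<^sub>v n = 0\<^sub>v m"
  by (intro eq_vecI) auto

lemma scalar_prod_congruence:
  fixes x :: "real vec"
  assumes C: "C \<in> carrier_mat n n" and x: "x \<in> carrier_vec n"
  shows "x \<bullet> ((C * mat_diag n f * transpose_mat C) *\<^sub>v x)
           = (\<Sum>i<n. f i * ((transpose_mat C *\<^sub>v x) $ i)\<^sup>2)"
proof -
  define y where "y = transpose_mat C *\<^sub>v x"
  have y: "y \<in> carrier_vec n" unfolding y_def using C x by simp
  have Dy: "mat_diag n f *\<^sub>v y = vec n (\<lambda>i. f i * y $ i)"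
    using y by (intro eq_vecI) (auto simp: mat_diag_def scalar_prod_def if_distrib if_distribR cong: if_cong)
  have "(C * mat_diag n f * transpose_mat C) *\<^sub>v x = C *\<^sub>v (mat_diag n f *\<^sub>v y)"
    unfolding y_def by (rule congruence_mult_vec[OF C mat_diag_dim x])
  also have "x \<bullet> \<dots> = y \<bullet> (mat_diag n f *\<^sub>v y)"
  proof -
    have "mat_diag n f *\<^sub>v y \<in> carrier_vec n" unfolding Dy by simp
    from transpose_vec_mult_scalar[OF C this x] show ?thesis unfolding y_def
      by simp
  qed
  also have "\<dots> = (\<Sum>i<n. f i * (y $ i)\<^sup>2)"
    unfolding Dy using y by (simp add: scalar_prod_def atLeast0LessThan power2_eq_square mult_ac)
  finally show ?thesis unfolding y_def .
qed

lemma orthonormal_mult_unit_vec: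
  assumes P: "orthonormal_mat n P" and i: "i < n"
  shows "transpose_mat P *\<^sub>v col P i = unit_vec n i"
proof -
  have Pc: "P \<in> carrier_mat n n" using P unfolding orthonormal_mat_def by auto
  have "transpose_mat P *\<^sub>v col P i = col (transpose_mat P * P) i"
    using Pc i by (intro col_mult2[symmetric]) auto
  thus ?thesis using P i unfolding orthonormal_mat_def by simp
qed

lemma spd_mat_orthogonal_diag:
  assumes P: "orthonormal_mat n P" and f: "\<And>i. i < n \<Longrightarrow> 0 < f i"
  shows "spd_mat (P * mat_diag n f * transpose_mat P)"
proof -
  have Pc: "P \<in> carrier_mat n n" and PP: "P * transpose_mat P = 1\<^sub>m n"
    using P unfolding orthonormal_mat_def by auto
  have "0 < x \<bullet> ((P * mat_diag n f * transpose_mat P) *\<^sub>v x)"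
    if x: "x \<in> carrier_vec n" and x0: "x \<noteq> 0\<^sub>v n" for x
  proof -
    let ?y = "transpose_mat P *\<^sub>v x"
    have y: "?y \<in> carrier_vec n" using Pc x by simp
    have "?y \<noteq> 0\<^sub>v n"
    proof
      assume y0: "?y = 0\<^sub>v n"
      have "x = (P * transpose_mat P) *\<^sub>v x" unfolding PP using x by simp
      also have "\<dots> = P *\<^sub>v ?y" using Pc x by (simp add: assoc_mult_mat_vec[of _ n n _ n])
      finally show False using x0 unfolding y0 mult_mat_zero_vec[OF Pc] by simp
    qed
    then obtain i where "i < n" "?y $ i \<noteq> 0" using y by (metis carrier_vecD eq_vecI index_zero_vec)
    thus ?thesis unfolding scalar_prod_congruence[OF Pc x]
      by (intro sum_pos2[of _ i]) (auto simp: f less_imp_le)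
  qed
  moreover have "transpose_mat (P * mat_diag n f * transpose_mat P) = P * mat_diag n f * transpose_mat P"
    using transpose_congruence[OF Pc, of "mat_diag n f"] by simp
  ultimately show ?thesis unfolding spd_mat_def using Pc by auto
qed

lemma spd_mat_carrier: "spd_mat M \<Longrightarrow> M \<in> carrier_mat (dim_row M) (dim_row M)"
  unfolding spd_mat_def by auto

lemma spd_mat_has_sqrt:
  assumes M: "M \<in> carrier_mat n n" and spd: "spd_mat M"
  shows "\<exists>S. spd_mat S \<and> S * S = M"
proof -
  from spd have sym: "transpose_mat M = M" unfolding spd_mat_def by simp
  obtain P f where P: "orthonormal_mat n P" and MP: "M = P * mat_diag n f * transpose_mat P"
    using symmetric_mat_diagonalization[OF M sym] by blast
  have Pc: "P \<in> carrier_mat n n" and PP: "transpose_mat P * P = 1\<^sub>m n"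
    using P unfolding orthonormal_mat_def by auto
  have f: "0 < f i" if i: "i < n" for i
  proof -
    have c: "col P i \<in> carrier_vec n" using Pc i by simp
    have e: "transpose_mat P *\<^sub>v col P i = unit_vec n i" by (rule orthonormal_mult_unit_vec[OF P i])
    hence "col P i \<noteq> 0\<^sub>v n" using i Pc
      by (metis index_unit_vec(1) index_zero_vec(1) mult_mat_zero_vec transpose_carrier_mat zero_neq_one)
    hence "0 < col P i \<bullet> (M *\<^sub>v col P i)" using spd c M unfolding spd_mat_def by auto
    also have "\<dots> = (\<Sum>j<n. f j * (unit_vec n i $ j)\<^sup>2)"
      unfolding MP scalar_prod_congruence[OF Pc c] e ..
    also have "\<dots> = (\<Sum>j<n. if j = i then f j else 0)" by (intro sum.cong) (auto simp: i)
    also have "\<dots> = f i" using i by simp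
    finally show ?thesis .
  qed
  define S where "S = P * mat_diag n (\<lambda>i. sqrt (f i)) * transpose_mat P"
  have "spd_mat S" unfolding S_def by (rule spd_mat_orthogonal_diag[OF P]) (simp add: f)
  moreover have "S * S = M"
  proof -
    let ?D = "mat_diag n (\<lambda>i. sqrt (f i))"
    have "S * S = P * (?D * ?D) * transpose_mat P"
      unfolding S_def by (rule orthonormal_congruence_mult[OF P]) auto
    also have "?D * ?D = mat_diag n f"
      unfolding mat_diag_diag by (rule eq_matI) (auto simp: mat_diag_def f less_imp_le)
    finally show ?thesis unfolding MP .
  qed
  ultimately show ?thesis by blast
qed

text \<open>
  The difference \<open>D = S - T\<close> satisfies \<open>S D + D T = S\<^sup>2 - T\<^sup>2 = 0\<close>. For an eigenvector \<open>v\<close> of \<open>D\<close> with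
  eigenvalue \<open>f\<close> this yields \<open>f * (v \<bullet> S v + v \<bullet> T v) = 0\<close>, hence \<open>f = 0\<close>. A symmetric matrix without
  nonzero eigenvalues is zero.
\<close>
lemma spd_mat_sqrt_unique:
  assumes M: "M \<in> carrier_mat n n" and S: "spd_mat S" "S * S = M" and T: "spd_mat T" "T * T = M"
  shows "S = T"
proof -
  have Sc: "S \<in> carrier_mat n n" using S M spd_mat_carrier[OF S(1)]
    by (metis carrier_matD(1) index_mult_mat(2))
  have Tc: "T \<in> carrier_mat n n" using T M spd_mat_carrier[OF T(1)]
    by (metis carrier_matD(1) index_mult_mat(2))
  define D where "D = S - T"
  have D: "D \<in> carrier_mat n n" unfolding D_def using Sc Tc by auto
  have Dt: "transpose_mat D = D"
    using S(1) T(1) Sc Tc unfolding D_def spd_mat_def by (simp add: transpose_minus[of _ n n])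
  have SD: "S * D = S * S - S * T"
    unfolding D_def by (rule mult_minus_distrib_mat[OF Sc Sc Tc])
  have DT: "D * T = S * T - T * T"
    unfolding D_def by (rule minus_mult_distrib_mat[OF Sc Tc Tc])
  have SDDT: "S * D + D * T = 0\<^sub>m n n"
    unfolding SD DT S(2) T(2) using M Sc Tc by (intro eq_matI) auto
  obtain P f where P: "orthonormal_mat n P" and DP: "D = P * mat_diag n f * transpose_mat P"
    using symmetric_mat_diagonalization[OF D Dt] by blast
  have Pc: "P \<in> carrier_mat n n" using P unfolding orthonormal_mat_def by auto
  have "f i = 0" if i: "i < n" for i
  proof -
    define v where "v = col P i"
    have v: "v \<in> carrier_vec n" unfolding v_def using Pc i by simp
    have e: "transpose_mat P *\<^sub>v v = unit_vec n i"
      unfolding v_def by (rule orthonormal_mult_unit_vec[OF P i])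
    hence v0: "v \<noteq> 0\<^sub>v n" using i Pc
      by (metis index_unit_vec(1) index_zero_vec(1) mult_mat_zero_vec transpose_carrier_mat zero_neq_one)
    have Dv: "D *\<^sub>v v = f i \<cdot>\<^sub>v v"
    proof -
      have "mat_diag n f *\<^sub>v unit_vec n i = f i \<cdot>\<^sub>v unit_vec n i"
        using i by (intro eq_vecI) (auto simp: mat_diag_def)
      moreover have "P *\<^sub>v unit_vec n i = v" unfolding v_def using Pc i by (intro eq_vecI) auto
      moreover have "D *\<^sub>v v = P *\<^sub>v (mat_diag n f *\<^sub>v (transpose_mat P *\<^sub>v v))"
        unfolding DP by (rule congruence_mult_vec[OF Pc mat_diag_dim v])
      ultimately show ?thesis unfolding e using Pc by (simp add: mult_mat_vec)
    qed
    have "v \<bullet> ((S * D) *\<^sub>v v) = f i * (v \<bullet> (S *\<^sub>v v))"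
      using Sc D v by (simp add: assoc_mult_mat_vec[of _ n n _ n] Dv mult_mat_vec)
    moreover have "v \<bullet> ((D * T) *\<^sub>v v) = f i * (v \<bullet> (T *\<^sub>v v))"
    proof -
      have "v \<bullet> ((D * T) *\<^sub>v v) = (transpose_mat D *\<^sub>v v) \<bullet> (T *\<^sub>v v)"
        using Tc D v transpose_vec_mult_scalar[OF D _ v, of "T *\<^sub>v v"]
        by (simp add: assoc_mult_mat_vec[of _ n n _ n])
      thus ?thesis unfolding Dt Dv using v Tc by simp
    qed
    moreover have "v \<bullet> ((S * D) *\<^sub>v v) + v \<bullet> ((D * T) *\<^sub>v v) = v \<bullet> ((S * D + D * T) *\<^sub>v v)"
      using Sc Tc D v
      by (simp add: add_mult_distrib_mat_vec[of _ n n] scalar_prod_add_distrib[of _ n])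
    moreover have "v \<bullet> ((S * D + D * T) *\<^sub>v v) = 0"
    proof -
      have "0\<^sub>m n n *\<^sub>v v = 0\<^sub>v n" using v by (intro eq_vecI) auto
      thus ?thesis unfolding SDDT using v by simp
    qed
    ultimately have "f i * (v \<bullet> (S *\<^sub>v v) + v \<bullet> (T *\<^sub>v v)) = 0" by (simp add: algebra_simps)
    moreover have "0 < v \<bullet> (S *\<^sub>v v)" "0 < v \<bullet> (T *\<^sub>v v)"
      using S(1) T(1) Sc Tc v v0 unfolding spd_mat_def by auto
    ultimately show ?thesis by simp
  qed
  hence "mat_diag n f = 0\<^sub>m n n" by (intro eq_matI) (auto simp: mat_diag_def)
  hence "D = 0\<^sub>m n n" unfolding DP using Pc by simp
  thus ?thesis unfolding D_def using Sc Tc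
    by (intro eq_matI) (auto, metis carrier_matD eq_iff_diff_eq_0 index_minus_mat(1) index_zero_mat(1))
qed

lemma sqrt_mat_spd:
  assumes M: "M \<in> carrier_mat n n" and spd: "spd_mat M"
  shows "sqrt_mat M \<in> carrier_mat n n" "spd_mat (sqrt_mat M)" "sqrt_mat M * sqrt_mat M = M"
    "transpose_mat (sqrt_mat M) = sqrt_mat M"
proof -
  have "\<exists>!S. spd_mat S \<and> S * S = M"
    using spd_mat_has_sqrt[OF M spd] spd_mat_sqrt_unique[OF M] by blast
  from theI'[OF this] show *: "spd_mat (sqrt_mat M)" "sqrt_mat M * sqrt_mat M = M"
    unfolding sqrt_mat_def by auto
  show "transpose_mat (sqrt_mat M) = sqrt_mat M" using *(1) unfolding spd_mat_def by simp
  show "sqrt_mat M \<in> carrier_mat n n" using * M spd_mat_carrier[OF *(1)]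
    by (metis carrier_matD(1) index_mult_mat(2))
qed

section \<open>Inverses\<close>

lemma inv_mat_eqI:
  assumes M: "M \<in> carrier_mat n n" and N: "N \<in> carrier_mat n n" and MN: "M * N = 1\<^sub>m n"
  shows "inv_mat M = N"
proof -
  have NM: "N * M = 1\<^sub>m n" using mat_mult_left_right_inverse[OF M N MN] .
  have "M \<in> Units (ring_mat TYPE(real) n ())"
    unfolding Units_def ring_mat_def using M N MN NM by auto
  then obtain B where B: "mat_inverse M = Some B" using mat_inverse(1)[OF M, of "()"]
    by (cases "mat_inverse M") auto
  from mat_inverse(2)[OF M B] have BM: "B * M = 1\<^sub>m n" and Bc: "B \<in> carrier_mat n n" by auto
  have "B = B * (M * N)" unfolding MN using Bc by simp
  also have "\<dots> = N" using assoc_mult_mat[OF Bc M N] BM N by simp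
  finally show ?thesis unfolding inv_mat_def B by simp
qed

lemma spd_mat_inv:
  assumes M: "M \<in> carrier_mat n n" and spd: "spd_mat M"
  shows "inv_mat M \<in> carrier_mat n n" "M * inv_mat M = 1\<^sub>m n" "inv_mat M * M = 1\<^sub>m n"
proof -
  have "det M \<noteq> 0"
  proof
    assume "det M = 0"
    then obtain v where v: "v \<in> carrier_vec n" "v \<noteq> 0\<^sub>v n" "M *\<^sub>v v = 0\<^sub>v n"
      using det_0_iff_vec_prod_zero_field[OF M] by auto
    hence "0 < v \<bullet> (0\<^sub>v n)" using spd M unfolding spd_mat_def by force
    thus False using v(1) by simp
  qed
  from det_non_zero_imp_unit[OF M this, of "()"]
  obtain N where N: "N \<in> carrier_mat n n" and MN: "M * N = 1\<^sub>m n"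
    unfolding Units_def ring_mat_def by auto
  have "inv_mat M = N" using inv_mat_eqI[OF M N MN] .
  thus "inv_mat M \<in> carrier_mat n n" "M * inv_mat M = 1\<^sub>m n" "inv_mat M * M = 1\<^sub>m n"
    using N MN mat_mult_left_right_inverse[OF M N MN] by auto
qed

section \<open>Determinants and quadratic forms under congruence\<close>

lemma det_mat_diag: "det (mat_diag n f) = (\<Prod>i<n. f i)" for f :: "nat \<Rightarrow> 'a :: comm_ring_1"
proof -
  have "det (mat_diag n f) = prod_list (diag_mat (mat_diag n f))"
    by (rule det_upper_triangular[of _ n]) (auto simp: mat_diag_def upper_triangular_def)
  also have "diag_mat (mat_diag n f) = map f [0..<n]"
    by (simp add: diag_mat_def mat_diag_def)
  finally show ?thesis by (simp add: prod.list_conv_set_nth atLeast0LessThan)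
qed

lemma det_congruence_mat_diag:
  fixes C :: "real mat"
  assumes C: "C \<in> carrier_mat n n"
  shows "det (C * mat_diag n f * transpose_mat C) = (det C)\<^sup>2 * (\<Prod>i<n. f i)"
proof -
  have D: "C * mat_diag n f \<in> carrier_mat n n" using C by (rule mult_carrier_mat) simp
  have Ct: "transpose_mat C \<in> carrier_mat n n" using C by simp
  show ?thesis unfolding det_mult[OF D Ct] det_mult[OF C mat_diag_dim] det_transpose[OF C] det_mat_diag
    by (simp add: power2_eq_square)
qed

text \<open>
  \<open>E\<close> is the inverse of \<open>C\<close>, so the inverse of \<open>C D C\<^sup>T\<close> is \<open>E\<^sup>T D\<^sup>-\<^sup>1 E\<close>.
\<close>
lemma mat_norm_inv_congruence:
  assumes C: "C \<in> carrier_mat n n" and E: "E \<in> carrier_mat n n" and CE: "C * E = 1\<^sub>m n"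
    and f: "\<And>i. i < n \<Longrightarrow> 0 < f i" and x: "x \<in> carrier_vec n"
  shows "(mat_norm (inv_mat (C * mat_diag n f * transpose_mat C)) x)\<^sup>2
           = (\<Sum>i<n. ((E *\<^sub>v x) $ i)\<^sup>2 / f i)"
proof -
  let ?D = "mat_diag n f" and ?D' = "mat_diag n (\<lambda>i. 1 / f i)"
  let ?Ct = "transpose_mat C" and ?Et = "transpose_mat E"
  have Ct: "?Ct \<in> carrier_mat n n" and Et: "?Et \<in> carrier_mat n n" using C E by auto
  have EC: "?Ct * ?Et = 1\<^sub>m n"
    using transpose_mult[OF E C] mat_mult_left_right_inverse[OF C E CE] by simp
  \<comment> \<open>The diagonal factors are made opaque so that only associativity rewrites the products.\<close>
  obtain D D' where DD: "D = ?D" "D' = ?D'" by blast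
  have Dc: "D \<in> carrier_mat n n" "D' \<in> carrier_mat n n" unfolding DD by simp_all
  have DD1: "D * D' = 1\<^sub>m n"
    unfolding DD mat_diag_diag using f by (intro eq_matI) (auto simp: mat_diag_def dest!: f)
  have "(C * D * ?Ct) * (?Et * D' * E) = C * D * (?Ct * ?Et) * (D' * E)"
    using C E Ct Et Dc by (simp add: assoc_mult_mat[of _ n n _ n _ n])
  also have "\<dots> = C * (D * D') * E" unfolding EC
    using C E Dc by (simp add: assoc_mult_mat[of _ n n _ n _ n])
  also have "\<dots> = 1\<^sub>m n" unfolding DD1 using C CE by simp
  finally have "inv_mat (C * D * ?Ct) = ?Et * D' * E"
    by (intro inv_mat_eqI[of _ n]) (use C E Ct Et Dc in auto)
  hence inv: "inv_mat (C * ?D * ?Ct) = ?Et * ?D' * transpose_mat ?Et" unfolding DD by simp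
  have "x \<bullet> (inv_mat (C * ?D * ?Ct) *\<^sub>v x) = (\<Sum>i<n. 1 / f i * ((E *\<^sub>v x) $ i)\<^sup>2)"
    unfolding inv scalar_prod_congruence[OF Et x] by simp
  moreover have "0 \<le> (\<Sum>i<n. 1 / f i * ((E *\<^sub>v x) $ i)\<^sup>2)"
    by (intro sum_nonneg) (auto simp: f less_imp_le)
  ultimately show ?thesis unfolding mat_norm_def by simp
qed

lemma ln_det_congruence:
  fixes C :: "real mat"
  assumes C: "C \<in> carrier_mat n n" and det: "det C \<noteq> 0" and f: "\<And>i. i < n \<Longrightarrow> 0 < f i"
  shows "ln (det (C * mat_diag n f * transpose_mat C)) = ln ((det C)\<^sup>2) + (\<Sum>i<n. ln (f i))"
proof -
  have "0 < (\<Prod>i<n. f i)" by (rule prod_pos) (simp add: f)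
  moreover have "ln (\<Prod>i<n. f i) = (\<Sum>i<n. ln (f i))" by (rule ln_prod) (auto dest!: f)
  moreover have "0 < (det C)\<^sup>2" using det by simp
  ultimately show ?thesis unfolding det_congruence_mat_diag[OF C] by (simp only: ln_mult_pos)
qed

section \<open>Rank and Gram matrix of a singular value decomposition\<close>

lemma sigma_mat_col:
  assumes "j < p" "j < n"
  shows "sigma_mat p n \<sigma> *\<^sub>v unit_vec n j = \<sigma> (Suc j) \<cdot>\<^sub>v unit_vec p j"
  using assms by (intro eq_vecI) (auto simp: sigma_mat_def)

text \<open>
  The first \<open>i\<close> columns of \<open>U\<close> are independent, and each of them lies in the column space:
  \<open>u\<^sub>j\<close> is the image of \<open>v\<^sub>j / \<sigma>\<^sub>j\<close>.
\<close>
lemma rank_svd_ge: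
  assumes U: "orthonormal_mat p U" and V: "orthonormal_mat n V"
    and i: "i \<le> p" "i \<le> n" and pos: "\<And>j. j < i \<Longrightarrow> \<sigma> (Suc j) \<noteq> 0"
  shows "i \<le> vec_space.rank p (U * sigma_mat p n \<sigma> * transpose_mat V)"
proof -
  interpret vec_space "TYPE(real)" p .
  let ?S = "sigma_mat p n \<sigma>"
  define B where "B = U * ?S * transpose_mat V"
  have Uc: "U \<in> carrier_mat p p" and UU: "transpose_mat U * U = 1\<^sub>m p"
    and Vc: "V \<in> carrier_mat n n"
    using U V unfolding orthonormal_mat_def by auto
  have S: "?S \<in> carrier_mat p n" unfolding sigma_mat_def by simp
  have Vt: "transpose_mat V \<in> carrier_mat n n" using Vc by simp
  have B: "B \<in> carrier_mat p n" unfolding B_def using Uc S Vt by simp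
  have detU: "det U \<noteq> 0"
  proof
    assume "det U = 0"
    hence "det (transpose_mat U * U) = 0" using Uc by (simp add: det_mult[of _ p])
    thus False unfolding UU by simp
  qed
  hence rk: "rank U = p" using det_rank_iff[OF Uc] by simp
  have dist: "distinct (cols U)" using non_distinct_low_rank[OF Uc] rk by fastforce
  have li: "lin_indpt (set (cols U))" by (rule full_rank_lin_indpt[OF Uc rk dist])
  define T where "T = col U ` {..<i}"
  have "T \<subseteq> set (cols U)" unfolding T_def using Uc i by (auto simp: cols_def)
  hence liT: "lin_indpt T" using li subset_li_is_li by blast
  have "inj_on (col U) {..<i}"
  proof (rule inj_onI)
    fix a b assume "a \<in> {..<i}" "b \<in> {..<i}" "col U a = col U b"
    thus "a = b" using dist Uc i nth_eq_iff_index_eq[OF dist, of a b] by (auto simp: cols_nth)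
  qed
  hence card: "card T = i" unfolding T_def by (simp add: card_image)
  have "T \<subseteq> col_space B"
  proof
    fix u assume "u \<in> T"
    then obtain j where j: "j < i" and u: "u = col U j" unfolding T_def by auto
    define x where "x = (1 / \<sigma> (Suc j)) \<cdot>\<^sub>v col V j"
    have jn: "j < n" and jp: "j < p" using i j by auto
    have cV: "col V j \<in> carrier_vec n" using Vc jn by simp
    have x: "x \<in> carrier_vec n" unfolding x_def using cV by simp
    have "transpose_mat V *\<^sub>v col V j = unit_vec n j" by (rule orthonormal_mult_unit_vec[OF V jn])
    hence "transpose_mat V *\<^sub>v x = (1 / \<sigma> (Suc j)) \<cdot>\<^sub>v unit_vec n j"
      unfolding x_def using Vt cV by (simp add: mult_mat_vec)
    hence "?S *\<^sub>v (transpose_mat V *\<^sub>v x) = (1 / \<sigma> (Suc j)) \<cdot>\<^sub>v (\<sigma> (Suc j) \<cdot>\<^sub>v unit_vec p j)"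
      using S sigma_mat_col[OF jp jn, of \<sigma>] by (simp add: mult_mat_vec[of _ p n])
    also have "\<dots> = unit_vec p j" using pos[OF j] by (simp add: smult_smult_assoc)
    finally have e: "?S *\<^sub>v (transpose_mat V *\<^sub>v x) = unit_vec p j" .
    have "B *\<^sub>v x = U *\<^sub>v (?S *\<^sub>v (transpose_mat V *\<^sub>v x))"
      unfolding B_def
      using assoc_mult_mat_vec[OF mult_carrier_mat[OF Uc S] Vt x]
        assoc_mult_mat_vec[OF Uc S mult_mat_vec_carrier[OF Vt x]] by simp
    also have "\<dots> = u" unfolding e u using Uc jp by (intro eq_vecI) auto
    finally show "u \<in> col_space B" unfolding col_space_eq[OF B] using x B Uc jp u by auto
  qed
  hence T: "T \<subseteq> span (set (cols B))" unfolding col_space_def .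
  have cB: "set (cols B) \<subseteq> carrier_vec p" using B cols_dim by blast
  have vs: "vectorspace class_ring (span_vs (set (cols B)))"
    using span_is_subspace[OF cB] subspace_is_vs by simp
  have li': "module.lin_indpt class_ring (span_vs (set (cols B))) T"
    using span_li_not_depend(2)[OF T] span_is_submodule[OF cB] liT by simp
  have "card T \<le> rank B"
    unfolding rank_def using vectorspace.li_le_dim(2)[OF vs fin_dim_span_cols[OF B] _ li'] T by simp
  thus ?thesis unfolding card B_def .
qed

text \<open>
  The hypothesis \<open>m \<le> n\<close> ensures that every row of the rectangular diagonal factor has a diagonal entry.
\<close>
lemma svd_gram_plus_one:
  assumes U: "orthonormal_mat m U" and V: "orthonormal_mat n V" and mn: "m \<le> n"
    and B: "B = U * sigma_mat m n \<sigma> * transpose_mat V"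
  shows "B * transpose_mat B + 1\<^sub>m m = U * mat_diag m (\<lambda>i. 1 + (\<sigma> (Suc i))\<^sup>2) * transpose_mat U"
proof -
  let ?S = "sigma_mat m n \<sigma>" and ?Ut = "transpose_mat U" and ?Vt = "transpose_mat V"
  let ?St = "transpose_mat ?S"
  have Uc: "U \<in> carrier_mat m m" and UU: "U * transpose_mat U = 1\<^sub>m m"
    and Vc: "V \<in> carrier_mat n n" and VV: "transpose_mat V * V = 1\<^sub>m n"
    using U V unfolding orthonormal_mat_def by auto
  have S: "?S \<in> carrier_mat m n" unfolding sigma_mat_def by simp
  have Ut: "?Ut \<in> carrier_mat m m" and Vt: "?Vt \<in> carrier_mat n n" and St: "?St \<in> carrier_mat n m"
    using Uc Vc S by auto
  have US: "U * ?S \<in> carrier_mat m n" using Uc S by simp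
  have Bt: "transpose_mat B = V * (?St * ?Ut)"
    unfolding B transpose_mult[OF US Vt] transpose_mult[OF Uc S] by simp
  have SU: "?St * ?Ut \<in> carrier_mat n m" using St Ut by simp
  have "B * transpose_mat B = U * ?S * (?Vt * (V * (?St * ?Ut)))"
    unfolding Bt unfolding B by (rule assoc_mult_mat[OF US Vt]) (use Vc SU in auto)
  also have "?Vt * (V * (?St * ?Ut)) = ?St * ?Ut"
    using assoc_mult_mat[OF Vt Vc SU, unfolded VV] SU by (metis left_mult_one_mat)
  also have "U * ?S * (?St * ?Ut) = U * (?S * ?St) * ?Ut"
    using assoc_mult_mat[OF US St Ut] assoc_mult_mat[OF Uc S St] by simp
  finally have BB: "B * transpose_mat B = U * (?S * ?St) * ?Ut" .
  have "?S * ?St = mat_diag m (\<lambda>i. (\<sigma> (Suc i))\<^sup>2)"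
  proof (rule eq_matI)
    fix i j assume "i < dim_row (mat_diag m (\<lambda>i. (\<sigma> (Suc i))\<^sup>2))"
      "j < dim_col (mat_diag m (\<lambda>i. (\<sigma> (Suc i))\<^sup>2))"
    hence i: "i < m" and j: "j < m" by auto
    have "(?S * ?St) $$ (i,j) = (\<Sum>k<n. ?S $$ (i,k) * ?S $$ (j,k))"
      using i j S by (simp add: scalar_prod_def atLeast0LessThan)
    also have "\<dots> = (\<Sum>k<n. if k = i then (if i = j then (\<sigma> (Suc i))\<^sup>2 else 0) else 0)"
      using i j by (intro sum.cong) (auto simp: sigma_mat_def power2_eq_square)
    also have "\<dots> = (if i = j then (\<sigma> (Suc i))\<^sup>2 else 0)" using i mn by simp
    finally show "(?S * ?St) $$ (i,j) = mat_diag m (\<lambda>i. (\<sigma> (Suc i))\<^sup>2) $$ (i,j)"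
      using i j by (simp add: mat_diag_def)
  qed (use S in auto)
  hence BB': "B * transpose_mat B = U * mat_diag m (\<lambda>i. (\<sigma> (Suc i))\<^sup>2) * ?Ut" using BB by simp
  have one: "1\<^sub>m m = U * 1\<^sub>m m * ?Ut" using UU Uc by simp
  have UD: "U * mat_diag m f \<in> carrier_mat m m" for f using Uc by (rule mult_carrier_mat) simp
  have "U * mat_diag m (\<lambda>i. (\<sigma> (Suc i))\<^sup>2) * ?Ut + U * 1\<^sub>m m * ?Ut
      = (U * mat_diag m (\<lambda>i. (\<sigma> (Suc i))\<^sup>2) + U * 1\<^sub>m m) * ?Ut"
    by (rule add_mult_distrib_mat[symmetric]) (use UD Uc Ut in auto)
  also have "U * mat_diag m (\<lambda>i. (\<sigma> (Suc i))\<^sup>2) + U * 1\<^sub>m m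
      = U * (mat_diag m (\<lambda>i. (\<sigma> (Suc i))\<^sup>2) + 1\<^sub>m m)"
    by (rule mult_add_distrib_mat[symmetric]) (use Uc in auto)
  also have "mat_diag m (\<lambda>i. (\<sigma> (Suc i))\<^sup>2) + 1\<^sub>m m = mat_diag m (\<lambda>i. 1 + (\<sigma> (Suc i))\<^sup>2)"
    by (intro eq_matI) (auto simp: mat_diag_def)
  finally show ?thesis unfolding BB' using one by simp
qed

text \<open>
  If \<open>\<sigma> (Suc i)\<close> were positive, so would be all earlier singular values, and the rank would exceed \<open>i\<close>.
\<close>
lemma singular_value_zero_beyond_rank:
  assumes B: "B \<in> carrier_mat m n" and mn: "m \<le> n" and svd: "is_svd B U \<sigma> V"
    and rank: "vec_space.rank m B \<le> i" and i: "i < m"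
  shows "\<sigma> (Suc i) = 0"
proof (rule ccontr)
  have dim: "dim_row B = m" "dim_col B = n" "min m n = m" using B mn by auto
  note svd' = svd[unfolded is_svd_def dim]
  have U: "orthonormal_mat m U" and V: "orthonormal_mat n V"
    and nonneg: "\<forall>i\<in>{1..m}. 0 \<le> \<sigma> i"
    and mono: "\<forall>i\<in>{1..m}. \<forall>j\<in>{1..m}. i \<le> j \<longrightarrow> \<sigma> j \<le> \<sigma> i"
    and B_eq: "B = U * sigma_mat m n \<sigma> * transpose_mat V"
    using svd' by blast+
  assume "\<sigma> (Suc i) \<noteq> 0"
  moreover have "0 \<le> \<sigma> (Suc i)" using nonneg i by simp
  ultimately have pos: "0 < \<sigma> (Suc i)" by simp
  have "\<sigma> (Suc j) \<noteq> 0" if "j < Suc i" for j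
  proof -
    have "\<sigma> (Suc i) \<le> \<sigma> (Suc j)" using mono that i by simp
    thus ?thesis using pos by simp
  qed
  hence "Suc i \<le> vec_space.rank m B"
    unfolding B_eq using i mn by (intro rank_svd_ge[OF U V]) auto
  thus False using rank by simp
qed

text \<open>
  With \<open>L = R\<^sup>1\<^sup>/\<^sup>2\<close> and \<open>S = Q\<^sup>1\<^sup>/\<^sup>2\<close> this says \<open>L (Ahat Ahat\<^sup>T + I) L = A Q A\<^sup>T + R\<close>.
\<close>
lemma whitened_gram:
  fixes A B L L' S :: "'a :: comm_ring_1 mat"
  assumes A: "A \<in> carrier_mat m n" and S: "S \<in> carrier_mat n n" and St: "transpose_mat S = S"
    and L: "L \<in> carrier_mat m m" and Lt: "transpose_mat L = L"
    and L': "L' \<in> carrier_mat m m" and LL': "L * L' = 1\<^sub>m m"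
    and B: "B = L' * A * S"
  shows "L * (B * transpose_mat B + 1\<^sub>m m) * L = A * (S * S) * transpose_mat A + L * L"
proof -
  have Bc: "B \<in> carrier_mat m n" unfolding B using L' A S by simp
  have LB: "L * B = A * S"
  proof -
    have "L * B = (L * L') * A * S"
      unfolding B using L L' A S
      by (simp add: assoc_mult_mat[of _ m m _ m _ n] assoc_mult_mat[of _ m m _ n _ n])
    thus ?thesis unfolding LL' using A by simp
  qed
  have At: "transpose_mat A \<in> carrier_mat n m" and Bt: "transpose_mat B \<in> carrier_mat n m"
    using A Bc by auto
  have BL: "transpose_mat B * L = S * transpose_mat A"
    using transpose_mult[OF L Bc] transpose_mult[OF A S] unfolding LB Lt St by simp
  have "L * (B * transpose_mat B + 1\<^sub>m m) * L = (L * (B * transpose_mat B) + L) * L"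
    using mult_add_distrib_mat[OF L mult_carrier_mat[OF Bc Bt] one_carrier_mat] L by simp
  also have "\<dots> = L * (B * transpose_mat B) * L + L * L"
    by (rule add_mult_distrib_mat[OF mult_carrier_mat[OF L mult_carrier_mat[OF Bc Bt]] L L])
  also have "L * (B * transpose_mat B) * L = (L * B) * (transpose_mat B * L)"
    using assoc_mult_mat[OF L Bc Bt] assoc_mult_mat[OF mult_carrier_mat[OF L Bc] Bt L] by simp
  also have "\<dots> = A * (S * S) * transpose_mat A"
    unfolding LB BL using assoc_mult_mat[OF A S S]
      assoc_mult_mat[OF mult_carrier_mat[OF A S] S At] by simp
  finally show ?thesis .
qed

section \<open>The effect of truncation\<close>

text \<open>
  The role of \<open>s i\<close> is that of \<open>\<sigma>\<^sub>i\<^sub>+\<^sub>1\<^sup>2\<close>, with indices shifted to start at 0, and \<open>t\<close> is its truncation.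
  Each discarded term contributes \<open>x\<^sub>i\<^sup>2 * (1 - 1 / (1 + s i))\<close> to the difference.
\<close>
lemma truncation_quadratic_bounds:
  fixes s t x :: "nat \<Rightarrow> real"
  assumes nonneg: "\<And>i. 0 \<le> s i"
    and top: "\<And>i. k \<le> i \<Longrightarrow> i < m \<Longrightarrow> s i \<le> s k"
    and t: "t = (\<lambda>i. if i < k then s i else 0)"
  shows "(\<Sum>i<m. (x i)\<^sup>2 / (1 + s i)) \<le> (\<Sum>i<m. (x i)\<^sup>2 / (1 + t i))"
    and "(\<Sum>i<m. (x i)\<^sup>2 / (1 + t i)) - (\<Sum>i<m. (x i)\<^sup>2 / (1 + s i))
           \<le> (\<Sum>i<m. (x i)\<^sup>2) * (s k / (1 + s k))"
proof -
  have pos: "0 < 1 + s i" for i using nonneg[of i] by linarith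
  show "(\<Sum>i<m. (x i)\<^sup>2 / (1 + s i)) \<le> (\<Sum>i<m. (x i)\<^sup>2 / (1 + t i))"
  proof (intro sum_mono divide_left_mono)
    fix i
    show "1 + t i \<le> 1 + s i" "0 < (1 + s i) * (1 + t i)" using nonneg[of i] pos[of i] by (auto simp: t)
  qed simp
  have "(x i)\<^sup>2 / (1 + t i) - (x i)\<^sup>2 / (1 + s i) \<le> (x i)\<^sup>2 * (s k / (1 + s k))" if i: "i < m" for i
  proof (cases "i < k")
    case True
    thus ?thesis using nonneg[of k] by (simp add: t)
  next
    case False
    have "(x i)\<^sup>2 / (1 + t i) - (x i)\<^sup>2 / (1 + s i) = (x i)\<^sup>2 * (1 - 1 / (1 + s i))"
      using False by (simp add: t algebra_simps)
    also have "\<dots> \<le> (x i)\<^sup>2 * (1 - 1 / (1 + s k))"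
    proof (rule mult_left_mono)
      have "1 / (1 + s k) \<le> 1 / (1 + s i)"
        using top[of i] False i pos[of i] by (intro frac_le) auto
      thus "1 - 1 / (1 + s i) \<le> 1 - 1 / (1 + s k)" by simp
    qed simp
    also have "1 - 1 / (1 + s k) = s k / (1 + s k)"
      using pos[of k] by (simp add: field_simps)
    finally show ?thesis .
  qed
  hence "(\<Sum>i<m. (x i)\<^sup>2 / (1 + t i) - (x i)\<^sup>2 / (1 + s i)) \<le> (\<Sum>i<m. (x i)\<^sup>2 * (s k / (1 + s k)))"
    by (intro sum_mono) simp
  thus "(\<Sum>i<m. (x i)\<^sup>2 / (1 + t i)) - (\<Sum>i<m. (x i)\<^sup>2 / (1 + s i))
           \<le> (\<Sum>i<m. (x i)\<^sup>2) * (s k / (1 + s k))"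
    by (simp only: sum_subtractf sum_distrib_right)
qed

lemma truncation_log_bounds:
  fixes s t :: "nat \<Rightarrow> real"
  assumes nonneg: "\<And>i. 0 \<le> s i"
    and zero: "\<And>i. r \<le> i \<Longrightarrow> i < m \<Longrightarrow> s i = 0"
    and t: "t = (\<lambda>i. if i < k then s i else 0)"
  shows "(\<Sum>i<m. ln (1 + t i)) \<le> (\<Sum>i<m. ln (1 + s i))"
    and "(\<Sum>i<m. ln (1 + s i)) - (\<Sum>i<m. ln (1 + t i)) \<le> (\<Sum>i=k..<r. ln (1 + s i))"
proof -
  have ln0: "0 \<le> ln (1 + s i)" for i using nonneg[of i] by simp
  show "(\<Sum>i<m. ln (1 + t i)) \<le> (\<Sum>i<m. ln (1 + s i))"
    by (intro sum_mono) (use ln0 in \<open>auto simp: t\<close>)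
  have "(\<Sum>i<m. ln (1 + s i)) - (\<Sum>i<m. ln (1 + t i)) = (\<Sum>i<m. if i < k then 0 else ln (1 + s i))"
    unfolding sum_subtractf[symmetric] by (intro sum.cong) (auto simp: t)
  also have "\<dots> = (\<Sum>i\<in>{..<m} \<inter> {k..<r}. ln (1 + s i))"
  proof (rule sum.mono_neutral_cong_right)
    show "\<forall>i\<in>{..<m} - {..<m} \<inter> {k..<r}. (if i < k then 0 else ln (1 + s i)) = 0"
    proof
      fix i assume i: "i \<in> {..<m} - {..<m} \<inter> {k..<r}"
      show "(if i < k then 0 else ln (1 + s i)) = 0"
        using i zero[of i] by (cases "i < k") auto
    qed
  qed auto
  also have "\<dots> \<le> (\<Sum>i=k..<r. ln (1 + s i))"
    by (intro sum_mono2) (auto simp: ln0)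
  finally show "(\<Sum>i<m. ln (1 + s i)) - (\<Sum>i<m. ln (1 + t i)) \<le> (\<Sum>i=k..<r. ln (1 + s i))" .
qed

text \<open>
  The bound for two covariance matrices that are congruent, through the same \<open>C\<close>, to a diagonal matrix
  with entries \<open>1 + s i\<close> and to its truncation. The constant \<open>c\<close> stands for the prior term.
\<close>
lemma truncation_bound_congruence:
  fixes C E :: "real mat" and y :: "real vec" and m k r :: nat and s t :: "nat \<Rightarrow> real" and c :: real
  defines "G \<equiv> \<lambda>f. c + 1/2 * ln (det (C * mat_diag m (\<lambda>i. 1 + f i) * transpose_mat C))
    + 1/2 * (mat_norm (inv_mat (C * mat_diag m (\<lambda>i. 1 + f i) * transpose_mat C)) y)\<^sup>2"
  assumes C: "C \<in> carrier_mat m m" and E: "E \<in> carrier_mat m m" and CE: "C * E = 1\<^sub>m m"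
    and y: "y \<in> carrier_vec m"
    and s0: "\<And>i. 0 \<le> s i"
    and s_top: "\<And>i. k \<le> i \<Longrightarrow> i < m \<Longrightarrow> s i \<le> s k"
    and s_zero: "\<And>i. r \<le> i \<Longrightarrow> i < m \<Longrightarrow> s i = 0"
    and t: "t = (\<lambda>i. if i < k then s i else 0)"
  shows "\<bar>G s - G t\<bar> \<le> 1/2 * (\<Sum>i=k..<r. ln (1 + s i))
    + 1/2 * ((mat_norm (inv_mat (C * mat_diag m (\<lambda>i. 1) * transpose_mat C)) y)\<^sup>2 * (s k / (1 + s k)))"
proof -
  have detC: "det C \<noteq> 0"
  proof
    assume "det C = 0"
    hence "det (C * E) = 0" unfolding det_mult[OF C E] by simp
    thus False unfolding CE by simp
  qed
  define x where "x i = (E *\<^sub>v y) $ i" for i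
  have s1: "0 < 1 + s i" and t1: "0 < 1 + t i" for i using s0[of i] unfolding t by auto
  note quad = mat_norm_inv_congruence[OF C E CE _ y, folded x_def]
  have norm: "(mat_norm (inv_mat (C * mat_diag m (\<lambda>i. 1) * transpose_mat C)) y)\<^sup>2 = (\<Sum>i<m. (x i)\<^sup>2)"
    using quad[of "\<lambda>i. 1"] by simp
  have Gs: "G s = c + 1/2 * (ln ((det C)\<^sup>2) + (\<Sum>i<m. ln (1 + s i))) + 1/2 * (\<Sum>i<m. (x i)\<^sup>2 / (1 + s i))"
    unfolding G_def quad[OF s1] ln_det_congruence[OF C detC s1] ..
  have Gt: "G t = c + 1/2 * (ln ((det C)\<^sup>2) + (\<Sum>i<m. ln (1 + t i))) + 1/2 * (\<Sum>i<m. (x i)\<^sup>2 / (1 + t i))"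
    unfolding G_def quad[OF t1] ln_det_congruence[OF C detC t1] ..
  have "(\<Sum>i<m. ln (1 + t i)) \<le> (\<Sum>i<m. ln (1 + s i))"
    "(\<Sum>i<m. ln (1 + s i)) - (\<Sum>i<m. ln (1 + t i)) \<le> (\<Sum>i=k..<r. ln (1 + s i))"
    using truncation_log_bounds[OF s0 _ t, of r m] s_zero by blast+
  moreover have "(\<Sum>i<m. (x i)\<^sup>2 / (1 + s i)) \<le> (\<Sum>i<m. (x i)\<^sup>2 / (1 + t i))"
    "(\<Sum>i<m. (x i)\<^sup>2 / (1 + t i)) - (\<Sum>i<m. (x i)\<^sup>2 / (1 + s i))
       \<le> (\<Sum>i<m. (x i)\<^sup>2) * (s k / (1 + s k))"
    using truncation_quadratic_bounds[OF s0 _ t, of m x] s_top by blast+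
  moreover have "\<bar>c + 1/2 * (e + a) + 1/2 * q - (c + 1/2 * (e + a') + 1/2 * q')\<bar> \<le> 1/2 * u + 1/2 * w"
    if "a' \<le> a" "a - a' \<le> u" "q \<le> q'" "q' - q \<le> w" for a a' e q q' u w :: real
    unfolding abs_le_iff using that by (simp add: field_simps)
  ultimately show ?thesis unfolding Gs Gt norm by blast
qed

theorem proposition3p1:
  fixes m n k r :: nat
    and A R Q Z Ahat U V Ahat\<^sub>k Z\<^sub>k :: "real mat"
    and \<mu> d :: "real vec"
    and \<sigma> :: "nat \<Rightarrow> real"
    and prior F F\<^sub>k \<beta>\<^sub>1 :: real
  assumes "0 < m" and "m \<le> n"
    and "A \<in> carrier_mat m n"
    and "R \<in> carrier_mat m m" and "diagonal_mat R" and "spd_mat R"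
    and "Q \<in> carrier_mat n n" and "spd_mat Q"
    and "\<mu> \<in> carrier_vec n" and "d \<in> carrier_vec m"
    and "0 < prior"
    and "Z = A * Q * transpose_mat A + R"
    and "F = - ln prior + 1/2 * ln (det Z) + 1/2 * (mat_norm (inv_mat Z) (A *\<^sub>v \<mu> - d))\<^sup>2"
    and "Ahat = inv_mat (sqrt_mat R) * A * sqrt_mat Q"
    and "r = vec_space.rank m Ahat"
    and "is_svd Ahat U \<sigma> V"
    and "1 \<le> k" and "k < r"
    and "Ahat\<^sub>k = truncated_svd k U \<sigma> V"
    and "Z\<^sub>k = sqrt_mat R * (Ahat\<^sub>k * transpose_mat Ahat\<^sub>k + 1\<^sub>m m) * sqrt_mat R"
    and "F\<^sub>k = - ln prior + 1/2 * ln (det Z\<^sub>k)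
               + 1/2 * (mat_norm (inv_mat Z\<^sub>k) (A *\<^sub>v \<mu> - d))\<^sup>2"
    and "\<beta>\<^sub>1 = mat_norm (inv_mat R) (A *\<^sub>v \<mu> - d)"
  shows "\<bar>F - F\<^sub>k\<bar> \<le> 1/2 * (\<Sum>i = k+1..r. ln (1 + (\<sigma> i)\<^sup>2))
                     + 1/2 * \<beta>\<^sub>1\<^sup>2 * ((\<sigma> (k+1))\<^sup>2 / (1 + (\<sigma> (k+1))\<^sup>2))"
proof -
  note mn = \<open>m \<le> n\<close> and A = \<open>A \<in> carrier_mat m n\<close>
    and R = \<open>R \<in> carrier_mat m m\<close> and Q = \<open>Q \<in> carrier_mat n n\<close>
    and svd = \<open>is_svd Ahat U \<sigma> V\<close>
  define L where "L = sqrt_mat R"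
  define L' where "L' = inv_mat L"
  define S where "S = sqrt_mat Q"
  note L = sqrt_mat_spd[OF R \<open>spd_mat R\<close>, folded L_def]
  note S = sqrt_mat_spd[OF Q \<open>spd_mat Q\<close>, folded S_def]
  note L' = spd_mat_inv[OF L(1,2), folded L'_def]
  have Ahat_eq: "Ahat = L' * A * S" unfolding L_def L'_def S_def by fact
  have Ahat: "Ahat \<in> carrier_mat m n" unfolding Ahat_eq using L'(1) A S(1) by simp
  have dim_Ahat: "dim_row Ahat = m" "dim_col Ahat = n" "min m n = m" using Ahat mn by auto
  note svd' = svd[unfolded is_svd_def dim_Ahat]
  have U: "orthonormal_mat m U" and V: "orthonormal_mat n V"
    and sv_nonneg: "\<forall>i\<in>{1..m}. 0 \<le> \<sigma> i"
    and sv_mono: "\<forall>i\<in>{1..m}. \<forall>j\<in>{1..m}. i \<le> j \<longrightarrow> \<sigma> j \<le> \<sigma> i"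
    and Ahat_svd: "Ahat = U * sigma_mat m n \<sigma> * transpose_mat V"
    using svd' by blast+
  have Uc: "U \<in> carrier_mat m m" and UU: "U * transpose_mat U = 1\<^sub>m m" and Vc: "V \<in> carrier_mat n n"
    using U V unfolding orthonormal_mat_def by auto
  have Ut: "transpose_mat U \<in> carrier_mat m m" using Uc by simp

  \<comment> \<open>Diagonal entries are indexed from 0, singular values from 1.\<close>
  define s where "s i = (\<sigma> (Suc i))\<^sup>2" for i
  define t where "t = (\<lambda>i. if i < k then s i else 0)"
  have s0: "0 \<le> s i" for i unfolding s_def by simp
  have s_zero: "s i = 0" if "r \<le> i" "i < m" for i
    using singular_value_zero_beyond_rank[OF Ahat mn svd _ that(2)] that(1) \<open>r = _\<close> unfolding s_def by simp
  have s_top: "s i \<le> s k" if "k \<le> i" "i < m" for i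
    unfolding s_def by (rule power_mono) (use sv_mono sv_nonneg that in auto)

  define C where "C = L * U"
  define E where "E = transpose_mat U * L'"
  have C: "C \<in> carrier_mat m m" and E: "E \<in> carrier_mat m m"
    unfolding C_def E_def using L(1) L'(1) Uc by auto
  have CE: "C * E = 1\<^sub>m m"
  proof -
    have "C * E = L * (U * transpose_mat U) * L'"
      unfolding C_def E_def using L(1) L'(1) Uc Ut by (simp add: assoc_mult_mat[of _ m m _ m _ m])
    thus ?thesis unfolding UU using L(1) L'(2) by simp
  qed
  have congr: "L * (U * mat_diag m f * transpose_mat U) * L = C * mat_diag m f * transpose_mat C" for f
    unfolding C_def congruence_congruence[OF L(1) Uc mat_diag_dim] L(4) ..
  have R_eq: "R = C * mat_diag m (\<lambda>i. 1) * transpose_mat C"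
    unfolding congr[symmetric] using Uc L(1) UU L(3) by simp
  have Z_eq: "Z = C * mat_diag m (\<lambda>i. 1 + s i) * transpose_mat C"
  proof -
    have "Z = L * (Ahat * transpose_mat Ahat + 1\<^sub>m m) * L"
      unfolding whitened_gram[OF A S(1,4) L(1,4) L'(1,2) Ahat_eq] S(3) L(3) by fact
    thus ?thesis unfolding svd_gram_plus_one[OF U V mn Ahat_svd] congr s_def .
  qed
  have Zk_eq: "Z\<^sub>k = C * mat_diag m (\<lambda>i. 1 + t i) * transpose_mat C"
  proof -
    define \<tau> where "\<tau> i = (if i \<le> k then \<sigma> i else 0)" for i
    have "Ahat\<^sub>k = U * sigma_mat m n \<tau> * transpose_mat V"
      unfolding \<open>Ahat\<^sub>k = _\<close> truncated_svd_def \<tau>_def using Uc Vc by simp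
    from svd_gram_plus_one[OF U V mn this]
    have "Z\<^sub>k = C * mat_diag m (\<lambda>i. 1 + (\<tau> (Suc i))\<^sup>2) * transpose_mat C"
      unfolding \<open>Z\<^sub>k = _\<close> L_def[symmetric] congr[symmetric] by simp
    moreover have "(\<lambda>i. 1 + (\<tau> (Suc i))\<^sup>2) = (\<lambda>i. 1 + t i)"
      unfolding \<tau>_def t_def s_def by auto
    ultimately show ?thesis by simp
  qed
  have y: "A *\<^sub>v \<mu> - d \<in> carrier_vec m" using A \<open>\<mu> \<in> carrier_vec n\<close> \<open>d \<in> carrier_vec m\<close> by simp
  have shift: "(\<Sum>i = k+1..r. ln (1 + (\<sigma> i)\<^sup>2)) = (\<Sum>i=k..<r. ln (1 + s i))"
    unfolding s_def using sum.shift_bounds_Suc_ivl[of "\<lambda>i. ln (1 + (\<sigma> i)\<^sup>2)" k r]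
    by (simp add: atLeastLessThanSuc_atLeastAtMost)
  have sk: "(\<sigma> (k+1))\<^sup>2 = s k" unfolding s_def by simp
  have "\<bar>F - F\<^sub>k\<bar> \<le> 1/2 * (\<Sum>i=k..<r. ln (1 + s i)) + 1/2 * (\<beta>\<^sub>1\<^sup>2 * (s k / (1 + s k)))"
    using truncation_bound_congruence[OF C E CE y s0 s_top s_zero t_def, where c = "- ln prior"]
    unfolding \<open>F = _\<close> \<open>F\<^sub>k = _\<close> \<open>\<beta>\<^sub>1 = _\<close> Z_eq Zk_eq R_eq[symmetric] .
  thus ?thesis unfolding shift sk by (simp only: mult.assoc)
qed

end
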